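(* Let $I\subset(0,\infty)$ be an interval, let $f:I\to\mathbb{R}$ be a differentiable function on the interior $I^\circ$, let $a,b\in I$ with $a<b$, and let $f'\in L[a,b]$. Let $\alpha>0$, $s\in(0,1]$ and $q\ge1$. If $|f'|^q$ is harmonically $s$-convex on $[a,b]$, then for all $x\in[a,b]$, $$|S_f(g;\alpha;x,a,b)|\le\left(\frac{1}{\alpha+1}\right)^{1-\frac1q}\Bigg\{\frac{(x-a)^{\alpha+1}}{(ax)^{\alpha-1}}\Big(\lambda_1(a,x,s,q,\alpha)|f'(x)|^q+\lambda_2(a,x,s,q,\alpha)|f'(a)|^q\Big)^{\frac1q}+\frac{(b-x)^{\alpha+1}}{(bx)^{\alpha-1}}\Big(\lambda_3(b,x,s,q,\alpha)|f'(x)|^q+\lambda_4(b,x,s,q,\alpha)|f'(b)|^q\Big)^{\frac1q}\Bigg\}.$$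
   Context: A function $h:K\to\mathbb{R}$ on an interval $K\subset(0,\infty)$ is harmonically $s$-convex ($s\in(0,1]$ fixed) if $h\left(\frac{uv}{tu+(1-t)v}\right)\le t^s h(v)+(1-t)^s h(u)$ for all $u,v\in K$, $t\in[0,1]$. With $g(u)=1/u$, $$S_f(g;\alpha;x,a,b)=\left[\left(\frac{x-a}{ax}\right)^{\alpha}+\left(\frac{b-x}{bx}\right)^{\alpha}\right]f(x)-\Gamma(\alpha+1)\left\{J_{1/x-}^{\alpha}(f\circ g)(1/b)+J_{1/x+}^{\alpha}(f\circ g)(1/a)\right\},$$ where $\Gamma$ is the Gamma function and the Riemann–Liouville fractional integrals are $J_{c+}^{\alpha}h(y)=\frac{1}{\Gamma(\alpha)}\int_c^y(y-t)^{\alpha-1}h(t)\,dt$ ($y>c$) and $J_{d-}^{\alpha}h(y)=\frac{1}{\Gamma(\alpha)}\int_y^d(t-y)^{\alpha-1}h(t)\,dt$ ($y<d$); an integral over a degenerate interval (when $x=a$ or $x=b$) is $0$. Beta function: $\beta(u,v)=\int_0^1t^{u-1}(1-t)^{v-1}dt$ for $u,v>0$. Hypergeometric function: ${}_2F_1(A,B;C;z)=\frac{1}{\beta(B,C-B)}\int_0^1t^{B-1}(1-t)^{C-B-1}(1-zt)^{-A}dt$ for $C>B>0$, $|z|<1$. Define $$\lambda_1(a,x,s,\vartheta,\rho)=\frac{\beta(\rho+s+1,1)}{x^{2\vartheta}}\,{}_2F_1\!\left(2\vartheta,\rho+s+1;\rho+s+2;1-\tfrac ax\right),$$ $$\lambda_2(a,x,s,\vartheta,\rho)=\frac{\beta(\rho+1,s+1)}{x^{2\vartheta}}\,{}_2F_1\!\left(2\vartheta,\rho+1;\rho+s+2;1-\tfrac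 ax\right),$$ $$\lambda_3(b,x,s,\vartheta,\rho)=\frac{\beta(1,\rho+s+1)}{b^{2\vartheta}}\,{}_2F_1\!\left(2\vartheta,1;\rho+s+2;1-\tfrac xb\right),$$ $$\lambda_4(b,x,s,\vartheta,\rho)=\frac{\beta(s+1,\rho+1)}{b^{2\vartheta}}\,{}_2F_1\!\left(2\vartheta,s+1;\rho+s+2;1-\tfrac xb\right).$$ $L[a,b]$ denotes the integrable functions on $[a,b]$. The derivative $f'$ is regarded as a function on $[a,b]$; if $a$ or $b$ is an endpoint of $I$, $f'$ there is the one-sided derivative. *)

theory Defs
  imports "HOL-Analysis.Analysis"
begin

definition harmonically_s_convex_on :: "real \<Rightarrow> real set \<Rightarrow> (real \<Rightarrow> real) \<Rightarrow> bool" where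
  "harmonically_s_convex_on s K h \<longleftrightarrow>
     (\<forall>u\<in>K. \<forall>v\<in>K. \<forall>t\<in>{0..1}.
        h (u * v / (t * u + (1 - t) * v)) \<le> t powr s * h v + (1 - t) powr s * h u)"

text \<open>
  Riemann--Liouville fractional integrals \<open>J\<^bsub>c+\<^esub>\<^sup>\<alpha> h (y)\<close> and
  \<open>J\<^bsub>d-\<^esub>\<^sup>\<alpha> h (y)\<close>. For \<open>y = c\<close> (resp. \<open>y = d\<close>) they are \<open>0\<close>, as the integral
  then ranges over a single point.
\<close>

definition RL_right :: "real \<Rightarrow> real \<Rightarrow> (real \<Rightarrow> real) \<Rightarrow> real \<Rightarrow> real" where
  "RL_right \<alpha> c h y = 1 / Gamma \<alpha> * (LINT t:{c..y}|lebesgue. (y - t) powr (\<alpha> - 1) * h t)"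

definition RL_left :: "real \<Rightarrow> real \<Rightarrow> (real \<Rightarrow> real) \<Rightarrow> real \<Rightarrow> real" where
  "RL_left \<alpha> d h y = 1 / Gamma \<alpha> * (LINT t:{y..d}|lebesgue. (t - y) powr (\<alpha> - 1) * h t)"

text \<open>The defect \<open>S\<^sub>f(g; \<alpha>; x, a, b)\<close>; it is only used for \<open>g u = 1 / u\<close>.\<close>

definition S_defect ::
  "(real \<Rightarrow> real) \<Rightarrow> (real \<Rightarrow> real) \<Rightarrow> real \<Rightarrow> real \<Rightarrow> real \<Rightarrow> real \<Rightarrow> real" where
  "S_defect f g \<alpha> x a b =
     (((x - a) / (a * x)) powr \<alpha> + ((b - x) / (b * x)) powr \<alpha>) * f x
     - Gamma (\<alpha> + 1) * (RL_left \<alpha> (1 / x) (f \<circ> g) (1 / b) + RL_right \<alpha> (1 / x) (f \<circ> g) (1 / a))"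

text \<open>
  The library defines \<open>Beta\<close> through \<open>Gamma\<close>; for positive arguments it is Euler's integral.
\<close>

lemma Beta_eq_Euler_integral:
  fixes u v :: real
  assumes "u > 0" "v > 0"
  shows "Beta u v = (LINT t:{0..1}|lebesgue. t powr (u - 1) * (1 - t) powr (v - 1))"
proof -
  have hi: "((\<lambda>t. t powr (u - 1) * (1 - t) powr (v - 1)) has_integral Beta u v) {0..1}"
    using has_integral_Beta_real[OF assms] .
  then have "(\<lambda>t. t powr (u - 1) * (1 - t) powr (v - 1)) absolutely_integrable_on {0..1}"
    by (intro nonnegative_absolutely_integrable_1) (auto simp: has_integral_integrable)
  then show ?thesis
    using set_lebesgue_integral_eq_integral(2) integral_unique[OF hi] by metis
qed

text \<open>Euler's integral for \<open>\<^sub>2F\<^sub>1(A, B; C; z)\<close>, for \<open>C > B > 0\<close> and \<open>\<bar>z\<bar> < 1\<close>.\<close>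

definition hyp2F1 :: "real \<Rightarrow> real \<Rightarrow> real \<Rightarrow> real \<Rightarrow> real" where
  "hyp2F1 A B C z = 1 / Beta B (C - B) *
     (LINT t:{0..1}|lebesgue. t powr (B - 1) * (1 - t) powr (C - B - 1) * (1 - z * t) powr (- A))"

definition lambda1 :: "real \<Rightarrow> real \<Rightarrow> real \<Rightarrow> real \<Rightarrow> real \<Rightarrow> real" where
  "lambda1 a x s \<theta> \<rho> = Beta (\<rho> + s + 1) 1 / x powr (2 * \<theta>) *
     hyp2F1 (2 * \<theta>) (\<rho> + s + 1) (\<rho> + s + 2) (1 - a / x)"

definition lambda2 :: "real \<Rightarrow> real \<Rightarrow> real \<Rightarrow> real \<Rightarrow> real \<Rightarrow> real" where
  "lambda2 a x s \<theta> \<rho> = Beta (\<rho> + 1) (s + 1) / x powr (2 * \<theta>) *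
     hyp2F1 (2 * \<theta>) (\<rho> + 1) (\<rho> + s + 2) (1 - a / x)"

definition lambda3 :: "real \<Rightarrow> real \<Rightarrow> real \<Rightarrow> real \<Rightarrow> real \<Rightarrow> real" where
  "lambda3 b x s \<theta> \<rho> = Beta 1 (\<rho> + s + 1) / b powr (2 * \<theta>) *
     hyp2F1 (2 * \<theta>) 1 (\<rho> + s + 2) (1 - x / b)"

definition lambda4 :: "real \<Rightarrow> real \<Rightarrow> real \<Rightarrow> real \<Rightarrow> real \<Rightarrow> real" where
  "lambda4 b x s \<theta> \<rho> = Beta (s + 1) (\<rho> + 1) / b powr (2 * \<theta>) *
     hyp2F1 (2 * \<theta>) (s + 1) (\<rho> + s + 2) (1 - x / b)"

end

theory Submission imports Defs begin

text \<open>
  Let \<open>p\<close> be \<open>a\<close> or \<open>b\<close> and \<open>A t = t p + (1 - t) x\<close>. An affine substitution turns the fractional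
  integral between \<open>1/x\<close> and \<open>1/p\<close> into a multiple of \<open>\<integral>\<^sub>0\<^sup>1 t\<^sup>\<alpha>\<^sup>-\<^sup>1 f (p x / A t) dt\<close>. Integrating
  the derivative of \<open>t\<^sup>\<alpha> f (p x / A t)\<close> over \<open>[0, 1]\<close> expresses \<open>f x\<close> minus \<open>\<alpha>\<close> times this integral
  as the integral of \<open>t\<^sup>\<alpha> f' (p x / A t)\<close> against a multiple of \<open>A t\<^sup>-\<^sup>2\<close>. Harmonic convexity bounds
  \<open>|f' (p x / A t)|\<close> pointwise by the \<open>q\<close>-th root of \<open>t\<^sup>s |f' x|\<^sup>q + (1 - t)\<^sup>s |f' p|\<^sup>q\<close>, and the power
  mean inequality with weight \<open>t\<^sup>\<alpha>\<close>, applied to this continuous majorant, leaves Euler integrals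
  of hypergeometric functions. The reflection \<open>t \<mapsto> 1 - t\<close> identifies \<open>\<lambda>\<^sub>3, \<lambda>\<^sub>4\<close> with
  \<open>\<lambda>\<^sub>1, \<lambda>\<^sub>2\<close>, so both endpoints are treated alike.
\<close>

section \<open>The weighted power mean inequality\<close>

text \<open>Integrating Young's inequality bounds the root by linear terms \<open>w t * g t\<close>
  and \<open>w t\<close>; optimising the free parameter then gives the product bound.\<close>

lemma power_mean_integral:
  fixes w g :: "'a::euclidean_space \<Rightarrow> real"
  assumes w: "w integrable_on S" "\<And>t. t \<in> S \<Longrightarrow> 0 \<le> w t" "integral S w > 0"
    and g: "\<And>t. t \<in> S \<Longrightarrow> 0 \<le> g t" "(\<lambda>t. w t * g t) integrable_on S"
    and u: "(\<lambda>t. w t * g t powr (1 / q)) integrable_on S"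
    and q: "q \<ge> 1"
  shows "integral S (\<lambda>t. w t * g t powr (1 / q))
    \<le> integral S w powr (1 - 1 / q) * integral S (\<lambda>t. w t * g t) powr (1 / q)"
proof -
  define W N X where "W = integral S w" and "N = integral S (\<lambda>t. w t * g t)"
    and "X = integral S (\<lambda>t. w t * g t powr (1 / q))"
  have W: "W > 0" using w by (simp add: W_def)
  have N: "N \<ge> 0" unfolding N_def using w g by (intro integral_nonneg) auto
  \<comment> \<open>Young's inequality with a free parameter \<open>M\<close>; the optimal choice is \<open>M = N / W\<close>.\<close>
  have young: "X * M powr (1 - 1 / q) \<le> 1 / q * N + (1 - 1 / q) * M * W" if M: "M > 0" for M
  proof -
    have pt: "w t * g t powr (1 / q) * M powr (1 - 1 / q)
        \<le> 1 / q * (w t * g t) + (1 - 1 / q) * M * w t" if t: "t \<in> S" for t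
    proof -
      have "g t powr (1 / q) * M powr (1 - 1 / q) \<le> 1 / q * g t + (1 - 1 / q) * M"
      \<comment> \<open>\<open>Youngs_inequality_0\<close> wants positive arguments. At
        \<open>g t = 0\<close> the left side is \<open>0\<close> and the right side
        nonnegative.\<close>
      proof (cases "g t = 0")
        case False
        then show ?thesis
          using Youngs_inequality_0[of "1 / q" "1 - 1 / q" "g t" M] g(1)[OF t] q M by auto
      qed (use q M in auto)
      then have "w t * (g t powr (1 / q) * M powr (1 - 1 / q))
          \<le> w t * (1 / q * g t + (1 - 1 / q) * M)"
        using w(2)[OF t] by (rule mult_left_mono)
      then show ?thesis by (simp add: algebra_simps)
    qed
    have i: "(\<lambda>t. w t * g t powr (1 / q) * M powr (1 - 1 / q)) integrable_on S"
      "(\<lambda>t. 1 / q * (w t * g t)) integrable_on S" "(\<lambda>t. (1 - 1 / q) * M * w t) integrable_on S"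
      by (intro integrable_on_mult_left integrable_on_mult_right u g(2) w(1))+
    have "integral S (\<lambda>t. w t * g t powr (1 / q) * M powr (1 - 1 / q))
        \<le> integral S (\<lambda>t. 1 / q * (w t * g t) + (1 - 1 / q) * M * w t)"
      using pt by (intro integral_le integrable_add i)
    then show ?thesis
      unfolding integral_add[OF i(2,3)] by (simp only: X_def N_def W_def integral_mult_left integral_mult_right)
  qed
  have "X \<le> W powr (1 - 1 / q) * N powr (1 / q)"
  proof (cases "N = 0")
    case True
    have "X \<le> 0"
    proof (rule field_le_epsilon)
      fix e :: real assume e: "e > 0"
      \<comment> \<open>The optimal \<open>M = N / W\<close> is \<open>0\<close> here, hence not
        admissible. This positive \<open>M\<close> is chosen so that
        \<open>M * W = e * M powr (1 - 1 / q)\<close>, which turns \<open>young\<close> into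
        \<open>X \<le> e\<close>.\<close>
      define M where "M = (e / W) powr q"
      have M: "M > 0" using e W by (simp add: M_def)
      have eq: "M = e / W * M powr (1 - 1 / q)"
      proof -
        have "M powr (1 / q) = e / W" using e W q by (simp add: M_def powr_powr)
        then show ?thesis using M powr_add[of M "1 / q" "1 - 1 / q"] by simp
      qed
      have "X * M powr (1 - 1 / q) \<le> (1 - 1 / q) * M * W"
        using young[OF M] True by simp
      also have "\<dots> \<le> M * W" using q M W by (simp add: mult_left_le_one_le field_simps)
      also have "\<dots> = e * M powr (1 - 1 / q)" by (subst eq) (use W in simp)
      finally show "X \<le> 0 + e" using M by simp
    qed
    then show ?thesis using True by simp
  next
    case False
    then have N: "N > 0" using N by simp
    \<comment> \<open>For \<open>M = N / W\<close> the right side of \<open>young\<close> collapses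
      to \<open>N\<close>. This factorisation exposes the positive power of \<open>N / W\<close>
      that cancels.\<close>
    have eq: "N = W powr (1 - 1 / q) * N powr (1 / q) * (N / W) powr (1 - 1 / q)"
      using N W by (simp add: powr_divide flip: powr_add)
    have "X * (N / W) powr (1 - 1 / q) \<le> N"
      using young[of "N / W"] N W by (simp add: field_simps)
    then have "X * (N / W) powr (1 - 1 / q) \<le> W powr (1 - 1 / q) * N powr (1 / q) * (N / W) powr (1 - 1 / q)"
      using eq by simp
    then show ?thesis using N W by simp
  qed
  then show ?thesis by (simp add: X_def W_def N_def)
qed

section \<open>Fractional integrals on the unit interval\<close>

text \<open>An unoriented segment allows \<open>y < x\<close>, so the substitution can start at
  whichever end carries the kernel singularity.\<close>

lemma set_lebesgue_integral_closed_segment: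
  fixes g :: "real \<Rightarrow> real"
  assumes "x \<noteq> y"
  shows "(LINT t:closed_segment x y|lebesgue. g t)
    = \<bar>y - x\<bar> * (LINT t:{0..1}|lebesgue. g (x + (y - x) * t))"
proof -
  have "indicator (closed_segment x y) (x + (y - x) * t) = (indicator {0..1} t :: real)" for t
  proof -
    have "x + (y - x) * t \<in> closed_segment x y \<longleftrightarrow> t \<in> {0..1}"
    proof -
      have "x + (y - x) * t = (1 - r) * x + r * y \<longleftrightarrow> (y - x) * (t - r) = 0" for r
        by (simp add: algebra_simps)
      then show ?thesis using assms by (auto simp: in_segment)
    qed
    then show ?thesis by (simp add: indicator_def)
  qed
  then show ?thesis
    using lebesgue_integral_real_affine[of "y - x" "\<lambda>t. indicator (closed_segment x y) t *\<^sub>R g t" x] assms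
    by (simp add: set_lebesgue_integral_def)
qed

lemma RL_left_unit_interval:
  assumes "y < d"
  shows "RL_left \<alpha> d h y
    = (d - y) powr \<alpha> / Gamma \<alpha> * (LINT t:{0..1}|lebesgue. t powr (\<alpha> - 1) * h (y + (d - y) * t))"
proof -
  have "(LINT t:{y..d}|lebesgue. (t - y) powr (\<alpha> - 1) * h t)
      = (d - y) * (LINT t:{0..1}|lebesgue. ((d - y) * t) powr (\<alpha> - 1) * h (y + (d - y) * t))"
    using set_lebesgue_integral_closed_segment[of y d "\<lambda>t. (t - y) powr (\<alpha> - 1) * h t"] assms
    by (simp add: closed_segment_eq_real_ivl)
  also have "(LINT t:{0..1}|lebesgue. ((d - y) * t) powr (\<alpha> - 1) * h (y + (d - y) * t))
      = (LINT t:{0..1}|lebesgue. (d - y) powr (\<alpha> - 1) * (t powr (\<alpha> - 1) * h (y + (d - y) * t)))"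
    using assms by (intro set_lebesgue_integral_cong) (auto simp: powr_mult)
  also have "\<dots> = (d - y) powr (\<alpha> - 1) * (LINT t:{0..1}|lebesgue. t powr (\<alpha> - 1) * h (y + (d - y) * t))"
    by (rule set_integral_mult_right)
  finally show ?thesis
    using assms by (simp add: RL_left_def powr_diff)
qed

text \<open>The segment is run backwards from \<open>y\<close> to \<open>c\<close>, which puts the
  kernel's critical point at \<open>t = 0\<close> and gives the same weight as for
  \<open>RL_left\<close>.\<close>

lemma RL_right_unit_interval:
  assumes "c < y"
  shows "RL_right \<alpha> c h y
    = (y - c) powr \<alpha> / Gamma \<alpha> * (LINT t:{0..1}|lebesgue. t powr (\<alpha> - 1) * h (y + (c - y) * t))"
proof -
  have "(LINT t:{c..y}|lebesgue. (y - t) powr (\<alpha> - 1) * h t)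
      = (y - c) * (LINT t:{0..1}|lebesgue. ((y - c) * t) powr (\<alpha> - 1) * h (y + (c - y) * t))"
    using set_lebesgue_integral_closed_segment[of y c "\<lambda>t. (y - t) powr (\<alpha> - 1) * h t"] assms
    by (simp add: closed_segment_eq_real_ivl algebra_simps)
  also have "(LINT t:{0..1}|lebesgue. ((y - c) * t) powr (\<alpha> - 1) * h (y + (c - y) * t))
      = (LINT t:{0..1}|lebesgue. (y - c) powr (\<alpha> - 1) * (t powr (\<alpha> - 1) * h (y + (c - y) * t)))"
    using assms by (intro set_lebesgue_integral_cong) (auto simp: powr_mult)
  also have "\<dots> = (y - c) powr (\<alpha> - 1) * (LINT t:{0..1}|lebesgue. t powr (\<alpha> - 1) * h (y + (c - y) * t))"
    by (rule set_integral_mult_right)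
  finally show ?thesis
    using assms by (simp add: RL_right_def powr_diff)
qed

section \<open>Hypergeometric coefficients as kernel integrals\<close>

lemma has_integral_reflect_unit_interval:
  fixes g :: "real \<Rightarrow> real"
  assumes "(g has_integral J) {0..1}"
  shows "((\<lambda>t. g (1 - t)) has_integral J) {0..1}"
  using has_integral_affinity[of g J 0 1 "-1" 1] assms by simp

lemma convex_combination_pos:
  fixes p x t :: real
  assumes "0 < p" "0 < x" "t \<in> {0..1}"
  shows "0 < t * p + (1 - t) * x"
  using assms by (cases "t = 0") (auto intro!: add_pos_nonneg)

text \<open>Since \<open>1 - (1 - p / x) * t\<close> is \<open>(t * p + (1 - t) * x) / x\<close>, a
  factor \<open>x powr A\<close> leaves the integral and cancels, as does the Beta factor. The
  kernel is nonnegative, so its gauge integral \<open>J\<close> is also the Lebesgue integral in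
  \<open>hyp2F1\<close>.\<close>

lemma hyp2F1_eq_kernel_integral:
  assumes pos: "0 < p" "0 < x" "0 < B" "0 < D" and C: "C = B + D"
    and J: "((\<lambda>t. t powr (B - 1) * (1 - t) powr (D - 1) * (t * p + (1 - t) * x) powr (- A))
      has_integral J) {0..1}"
  shows "Beta B D / x powr A * hyp2F1 A B C (1 - p / x) = J"
proof -
  let ?k = "\<lambda>t. t powr (B - 1) * (1 - t) powr (D - 1) * (t * p + (1 - t) * x) powr (- A)"
  have "?k absolutely_integrable_on {0..1}"
    using J by (intro nonnegative_absolutely_integrable_1) (auto simp: has_integral_integrable)
  then have k: "(LINT t:{0..1}|lebesgue. ?k t) = J"
    using integral_unique[OF J] by (simp add: set_lebesgue_integral_eq_integral(2))
  have "(1 - (1 - p / x) * t) powr (- A) = x powr A * (t * p + (1 - t) * x) powr (- A)"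
    if t: "t \<in> {0..1}" for t
  proof -
    have "1 - (1 - p / x) * t = (t * p + (1 - t) * x) / x"
      using pos by (simp add: field_simps)
    then show ?thesis
      using pos convex_combination_pos[OF pos(1,2) t] by (simp add: powr_divide powr_minus_divide)
  qed
  then have "(LINT t:{0..1}|lebesgue. t powr (B - 1) * (1 - t) powr (C - B - 1) * (1 - (1 - p / x) * t) powr (- A))
      = (LINT t:{0..1}|lebesgue. x powr A * ?k t)"
    using C by (intro set_lebesgue_integral_cong) auto
  also have "\<dots> = x powr A * J" by (simp only: set_integral_mult_right k)
  moreover have "Beta B D > 0"
    unfolding Beta_def using pos by (intro divide_pos_pos mult_pos_pos Gamma_real_pos) auto
  ultimately show ?thesis using pos C by (simp add: hyp2F1_def)
qed


lemma continuous_on_powr_harmonic_denominator: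
  fixes p x A :: real
  assumes "0 < p" "0 < x"
  shows "continuous_on {0..1} (\<lambda>t. (t * p + (1 - t) * x) powr A)"
  using convex_combination_pos[OF assms] by (intro continuous_intros) fastforce

text \<open>Here \<open>B = \<rho> + s + 1\<close> and \<open>D = 1\<close>. Positivity of
  \<open>\<rho> + s\<close> makes the kernel continuous up to \<open>t = 0\<close>, hence
  integrable.\<close>

lemma has_integral_lambda1:
  assumes pos: "0 < p" "0 < x" "0 < \<rho>" "0 < s"
  shows "((\<lambda>t. t powr (\<rho> + s) * (t * p + (1 - t) * x) powr (- (2 * \<theta>)))
    has_integral lambda1 p x s \<theta> \<rho>) {0..1}" (is "(?k has_integral _) _")
proof -
  have "continuous_on {0..1} ?k"
    using pos by (intro continuous_on_mult continuous_on_powr_harmonic_denominator continuous_on_powr')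
      (auto intro!: continuous_intros)
  then have k: "(?k has_integral integral {0..1} ?k) {0..1}"
    by (intro integrable_integral integrable_continuous_real)
  \<comment> \<open>\<open>(1 - t) powr 0\<close> is \<open>0\<close>, not \<open>1\<close>, at \<open>t = 1\<close>.\<close>
  have "((\<lambda>t. t powr (\<rho> + s + 1 - 1) * (1 - t) powr (1 - 1) * (t * p + (1 - t) * x) powr (- (2 * \<theta>)))
      has_integral integral {0..1} ?k) {0..1}"
    by (rule has_integral_spike_finite[OF _ _ k, of "{1}"]) auto
  from hyp2F1_eq_kernel_integral[OF _ _ _ _ _ this] k pos show ?thesis
    by (simp add: lambda1_def add_ac)
qed

lemma has_integral_lambda2:
  assumes pos: "0 < p" "0 < x" "0 < \<rho>" "0 < s"
  shows "((\<lambda>t. t powr \<rho> * (1 - t) powr s * (t * p + (1 - t) * x) powr (- (2 * \<theta>)))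
    has_integral lambda2 p x s \<theta> \<rho>) {0..1}" (is "(?k has_integral _) _")
proof -
  have "continuous_on {0..1} ?k"
    using pos by (intro continuous_on_mult continuous_on_powr_harmonic_denominator continuous_on_powr')
      (auto intro!: continuous_intros)
  then have k: "(?k has_integral integral {0..1} ?k) {0..1}"
    by (intro integrable_integral integrable_continuous_real)
  then have "((\<lambda>t. t powr (\<rho> + 1 - 1) * (1 - t) powr (s + 1 - 1) * (t * p + (1 - t) * x) powr (- (2 * \<theta>)))
      has_integral integral {0..1} ?k) {0..1}"
    by simp
  from hyp2F1_eq_kernel_integral[OF _ _ _ _ _ this] k pos show ?thesis
    by (simp add: lambda2_def add_ac)
qed

text \<open>The reflection of Euler's integral is Pfaff's transformation. For \<open>p > x\<close>
  the argument \<open>1 - p / x\<close> of \<open>lambda1\<close> may lie below \<open>-1\<close>,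
  but the integrand in \<open>hyp2F1\<close> keeps a positive base on the unit interval.\<close>

lemma lambda3_eq_lambda1:
  assumes pos: "0 < p" "0 < x" "0 < \<rho>" "0 < s"
  shows "lambda3 p x s \<theta> \<rho> = lambda1 p x s \<theta> \<rho>"
proof -
  let ?J = "lambda1 p x s \<theta> \<rho>"
  have "((\<lambda>t. (1 - t) powr (\<rho> + s) * ((1 - t) * p + (1 - (1 - t)) * x) powr (- (2 * \<theta>)))
      has_integral ?J) {0..1}"
    by (rule has_integral_reflect_unit_interval[OF has_integral_lambda1[OF pos]])
  then have k: "((\<lambda>t. (1 - t) powr (\<rho> + s) * (t * x + (1 - t) * p) powr (- (2 * \<theta>)))
      has_integral ?J) {0..1}"
    by (simp add: add.commute)
  \<comment> \<open>The factor \<open>t powr (1 - 1)\<close> is \<open>0\<close> instead of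
    \<open>1\<close> at \<open>t = 0\<close>, a single point that does not affect the
    integral.\<close>
  have "((\<lambda>t. t powr (1 - 1) * (1 - t) powr (\<rho> + s + 1 - 1) * (t * x + (1 - t) * p) powr (- (2 * \<theta>)))
      has_integral ?J) {0..1}"
    by (rule has_integral_spike_finite[OF _ _ k, of "{0}"]) auto
  from hyp2F1_eq_kernel_integral[OF _ _ _ _ _ this] pos show ?thesis
    by (simp add: lambda3_def add_ac)
qed

lemma lambda4_eq_lambda2:
  assumes pos: "0 < p" "0 < x" "0 < \<rho>" "0 < s"
  shows "lambda4 p x s \<theta> \<rho> = lambda2 p x s \<theta> \<rho>"
proof -
  let ?J = "lambda2 p x s \<theta> \<rho>"
  have "((\<lambda>t. (1 - t) powr \<rho> * (1 - (1 - t)) powr s * ((1 - t) * p + (1 - (1 - t)) * x) powr (- (2 * \<theta>)))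
      has_integral ?J) {0..1}"
    by (rule has_integral_reflect_unit_interval[OF has_integral_lambda2[OF pos]])
  then have "((\<lambda>t. t powr (s + 1 - 1) * (1 - t) powr (\<rho> + 1 - 1) * (t * x + (1 - t) * p) powr (- (2 * \<theta>)))
      has_integral ?J) {0..1}"
    by (simp add: add.commute mult.commute)
  from hyp2F1_eq_kernel_integral[OF _ _ _ _ _ this] pos show ?thesis
    by (simp add: lambda4_def add_ac)
qed

section \<open>The estimate for one endpoint\<close>

text \<open>The harmonic mean is an ordinary convex combination of \<open>p\<close> and
  \<open>x\<close>, with weights \<open>(1 - t) * x / ?A\<close> and
  \<open>t * p / ?A\<close>.\<close>

lemma harmonic_combination_mem:
  fixes p x t :: real
  assumes K: "convex K" "p \<in> K" "x \<in> K" "K \<subseteq> {0<..}" and t: "t \<in> {0..1}"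
  shows "p * x / (t * p + (1 - t) * x) \<in> K"
proof -
  let ?A = "t * p + (1 - t) * x"
  have pos: "0 < p" "0 < x" using K by auto
  then have A: "0 < ?A" using convex_combination_pos t by blast
  have "((1 - t) * x / ?A) *\<^sub>R p + (t * p / ?A) *\<^sub>R x \<in> K"
  proof (rule convexD[OF K(1-3)])
    show "(1 - t) * x / ?A + t * p / ?A = 1"
      using A by (simp flip: add_divide_distrib)
  qed (use pos A t in auto)
  also have "((1 - t) * x / ?A) *\<^sub>R p + (t * p / ?A) *\<^sub>R x = p * x / ?A"
    by (simp add: add_divide_distrib[symmetric]) (simp add: algebra_simps)
  finally show ?thesis .
qed

text \<open>No order between \<open>p\<close> and \<open>x\<close> is fixed, so the estimate serves
  \<open>a\<close> and \<open>b\<close> alike. Derivatives within \<open>K\<close> accommodate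
  one-sided derivatives at its ends.\<close>

lemma harmonic_average_defect_bound:
  fixes f f' :: "real \<Rightarrow> real"
  assumes K: "convex K" "p \<in> K" "x \<in> K" "K \<subseteq> {0<..}"
    and f': "\<And>y. y \<in> K \<Longrightarrow> (f has_real_derivative f' y) (at y within K)"
    and par: "0 < \<alpha>" "0 < s" "1 \<le> q"
    and hc: "harmonically_s_convex_on s K (\<lambda>y. \<bar>f' y\<bar> powr q)"
  shows "\<bar>f x - \<alpha> * (LINT t:{0..1}|lebesgue. t powr (\<alpha> - 1) * f (p * x / (t * p + (1 - t) * x)))\<bar>
    \<le> p * x * \<bar>x - p\<bar> * ((1 / (\<alpha> + 1)) powr (1 - 1 / q) *
      (lambda1 p x s q \<alpha> * \<bar>f' x\<bar> powr q + lambda2 p x s q \<alpha> * \<bar>f' p\<bar> powr q) powr (1 / q))"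
proof -
  define A where "A t = t * p + (1 - t) * x" for t
  define \<phi> where "\<phi> t = f (p * x / A t)" for t
  define \<phi>' where "\<phi>' t = f' (p * x / A t) * (- (p * x * (p - x)) / (A t)\<^sup>2)" for t
  define c where "c = p * x * \<bar>x - p\<bar>"
  \<comment> \<open>The exponent \<open>-(2 * q)\<close> is chosen so that the \<open>q\<close>-th
    root yields the chain rule factor \<open>1 / (A t)\<^sup>2\<close> of
    \<open>\<phi>'\<close>.\<close>
  define G where "G t = (t powr s * \<bar>f' x\<bar> powr q + (1 - t) powr s * \<bar>f' p\<bar> powr q) * A t powr (- (2 * q))" for t
  have pos: "0 < p" "0 < x" using K by auto
  have A: "0 < A t" if "t \<in> {0..1}" for t
    using convex_combination_pos[OF pos that] by (simp add: A_def)
  have mem: "p * x / A t \<in> K" if "t \<in> {0..1}" for t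
    using harmonic_combination_mem[OF K that] by (simp add: A_def)
  have dA: "(A has_real_derivative p - x) (at t within S)" for t S
    unfolding A_def by (auto intro!: derivative_eq_intros)
  have d\<phi>: "(\<phi> has_real_derivative \<phi>' t) (at t within {0..1})" if t: "t \<in> {0..1}" for t
  proof -
    have inner: "((\<lambda>t. p * x / A t) has_real_derivative - (p * x * (p - x)) / (A t)\<^sup>2) (at t within {0..1})"
      using A[OF t] by (auto intro!: derivative_eq_intros dA simp: power2_eq_square)
    have outer: "(f has_real_derivative f' (p * x / A t)) (at (p * x / A t) within (\<lambda>t. p * x / A t) ` {0..1})"
      using mem by (intro DERIV_subset[OF f'[OF mem[OF t]]]) auto
    show ?thesis
      using DERIV_image_chain[OF outer inner] unfolding \<phi>_def \<phi>'_def o_def .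
  qed
  have cont\<phi>: "continuous_on {0..1} \<phi>"
    using d\<phi> by (rule DERIV_continuous_on)
  have contpow: "continuous_on {0..1} (\<lambda>t::real. t powr \<beta>)" if "0 < \<beta>" for \<beta>
    using that by (intro continuous_on_powr') (auto intro!: continuous_intros)
  \<comment> \<open>For \<open>\<alpha> < 1\<close> this weight is unbounded near \<open>0\<close>,
    so continuity is no argument; multiplying by the bounded continuous \<open>\<phi>\<close>
    preserves its absolute integrability.\<close>
  have pow_ai: "(\<lambda>t. t powr (\<alpha> - 1)) absolutely_integrable_on {0..1}"
    using has_integral_powr_from_0[of "\<alpha> - 1" 1] par
    by (intro nonnegative_absolutely_integrable_1) (auto simp: has_integral_integrable)
  have "(\<lambda>t. \<phi> t * t powr (\<alpha> - 1)) absolutely_integrable_on {0..1}"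
    using cont\<phi> pow_ai
    by (intro absolutely_integrable_bounded_measurable_product_real
        continuous_imp_measurable_on_sets_lebesgue)
      (auto intro!: compact_imp_bounded compact_continuous_image)
  then have ai: "(\<lambda>t. t powr (\<alpha> - 1) * \<phi> t) absolutely_integrable_on {0..1}"
    by (simp add: mult.commute)
  define J where "J = (LINT t:{0..1}|lebesgue. t powr (\<alpha> - 1) * \<phi> t)"
  have J: "((\<lambda>t. t powr (\<alpha> - 1) * \<phi> t) has_integral J) {0..1}"
    unfolding J_def using has_integral_set_lebesgue[OF ai] .
  have "((\<lambda>t. \<alpha> * (t powr (\<alpha> - 1) * \<phi> t) + t powr \<alpha> * \<phi>' t) has_integral
      1 powr \<alpha> * \<phi> 1 - 0 powr \<alpha> * \<phi> 0) {0..1}"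
  \<comment> \<open>For \<open>\<alpha> < 1\<close> the factor \<open>t powr \<alpha>\<close> has no
    finite derivative at \<open>0\<close>; the interior version asks only for continuity
    there.\<close>
  proof (rule fundamental_theorem_of_calculus_interior)
    show "continuous_on {0..1} (\<lambda>t. t powr \<alpha> * \<phi> t)"
      using par by (intro continuous_on_mult contpow cont\<phi>)
    fix t :: real assume t: "t \<in> {0<..<1}"
    then have "(\<phi> has_real_derivative \<phi>' t) (at t)"
      using d\<phi>[of t] at_within_interior[of t "{0..1}"] by simp
    then show "((\<lambda>t. t powr \<alpha> * \<phi> t) has_vector_derivative
        \<alpha> * (t powr (\<alpha> - 1) * \<phi> t) + t powr \<alpha> * \<phi>' t) (at t)"
      unfolding has_real_derivative_iff_has_vector_derivative[symmetric]
      using t by (auto intro!: derivative_eq_intros simp: powr_diff field_simps)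
  qed simp
  \<comment> \<open>Subtraction also yields gauge integrability of
    \<open>t powr \<alpha> * \<phi>' t\<close>. The boundary term at \<open>0\<close> vanishes, and
    \<open>A 1 = p\<close> makes the one at \<open>1\<close> equal to \<open>f x\<close>.\<close>
  from has_integral_diff[OF this has_integral_mult_right[OF J, of \<alpha>]]
  have by_parts: "((\<lambda>t. t powr \<alpha> * \<phi>' t) has_integral f x - \<alpha> * J) {0..1}"
    using pos par by (simp add: \<phi>_def A_def)
  have bound: "\<bar>t powr \<alpha> * \<phi>' t\<bar> \<le> c * (t powr \<alpha> * G t powr (1 / q))" if t: "t \<in> {0..1}" for t
  proof -
    let ?h = "t powr s * \<bar>f' x\<bar> powr q + (1 - t) powr s * \<bar>f' p\<bar> powr q"
    have "\<bar>f' (p * x / A t)\<bar> powr q \<le> ?h"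
      using hc[unfolded harmonically_s_convex_on_def, rule_format, OF K(2,3) t] by (simp add: A_def)
    then have "(\<bar>f' (p * x / A t)\<bar> powr q) powr (1 / q) \<le> ?h powr (1 / q)"
      using par by (intro powr_mono2) auto
    then have f'_le: "\<bar>f' (p * x / A t)\<bar> \<le> ?h powr (1 / q)"
      using par by (simp add: powr_powr)
    have "(A t powr (- (2 * q))) powr (1 / q) = A t powr (- 2)"
      using par by (simp add: powr_powr)
    also have "\<dots> = 1 / (A t)\<^sup>2"
      using A[OF t] by (simp add: powr_minus_divide)
    finally have G: "G t powr (1 / q) = ?h powr (1 / q) / (A t)\<^sup>2"
      using A[OF t] by (simp add: G_def powr_mult)
    have "\<bar>\<phi>' t\<bar> = c * (\<bar>f' (p * x / A t)\<bar> / (A t)\<^sup>2)"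
      using pos by (simp add: \<phi>'_def c_def abs_mult abs_minus_commute)
    also have "\<dots> \<le> c * G t powr (1 / q)"
      unfolding G using f'_le pos by (intro mult_left_mono divide_right_mono) (auto simp: c_def)
    finally have "t powr \<alpha> * \<bar>\<phi>' t\<bar> \<le> t powr \<alpha> * (c * G t powr (1 / q))"
      by (rule mult_left_mono) simp
    then show ?thesis by (simp add: abs_mult mult_ac)
  qed
  have powA: "continuous_on {0..1} (\<lambda>t. A t powr \<beta>)" for \<beta>
    unfolding A_def by (rule continuous_on_powr_harmonic_denominator[OF pos])
  have "continuous_on {0..1} (\<lambda>t::real. (1 - t) powr s)"
    using par by (intro continuous_on_powr') (auto intro!: continuous_intros)
  then have contG: "continuous_on {0..1} G"
    unfolding G_def using par
    by (intro continuous_on_mult continuous_on_add continuous_on_const contpow powA)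
  have G0: "0 \<le> G t" for t
    by (simp add: G_def)
  have u: "(\<lambda>t. t powr \<alpha> * G t powr (1 / q)) integrable_on {0..1}"
    using par G0 contG
    by (intro integrable_continuous_real continuous_on_mult contpow continuous_on_powr') auto
  have w: "((\<lambda>t. t powr \<alpha>) has_integral 1 / (\<alpha> + 1)) {0..1}"
    using has_integral_powr_from_0[of \<alpha> 1] par by simp
  have "((\<lambda>t. t powr (\<alpha> + s) * A t powr (- (2 * q)) * \<bar>f' x\<bar> powr q
        + t powr \<alpha> * (1 - t) powr s * A t powr (- (2 * q)) * \<bar>f' p\<bar> powr q)
      has_integral lambda1 p x s q \<alpha> * \<bar>f' x\<bar> powr q + lambda2 p x s q \<alpha> * \<bar>f' p\<bar> powr q) {0..1}"
    unfolding A_def using pos par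
    by (intro has_integral_add has_integral_mult_left has_integral_lambda1 has_integral_lambda2)
  also have "(\<lambda>t. t powr (\<alpha> + s) * A t powr (- (2 * q)) * \<bar>f' x\<bar> powr q
        + t powr \<alpha> * (1 - t) powr s * A t powr (- (2 * q)) * \<bar>f' p\<bar> powr q) = (\<lambda>t. t powr \<alpha> * G t)"
    by (simp add: G_def powr_add algebra_simps)
  finally have wG: "((\<lambda>t. t powr \<alpha> * G t)
      has_integral lambda1 p x s q \<alpha> * \<bar>f' x\<bar> powr q + lambda2 p x s q \<alpha> * \<bar>f' p\<bar> powr q) {0..1}" .
  have "\<bar>f x - \<alpha> * J\<bar> = \<bar>integral {0..1} (\<lambda>t. t powr \<alpha> * \<phi>' t)\<bar>"
    by (simp add: integral_unique[OF by_parts])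
  \<comment> \<open>Domination for gauge integrals: the integrand and the majorant must be
    integrable, the absolute value of the integrand need not be.\<close>
  also have "\<dots> \<le> integral {0..1} (\<lambda>t. c * (t powr \<alpha> * G t powr (1 / q)))"
    using integral_norm_bound_integral[OF has_integral_integrable[OF by_parts] integrable_on_mult_right[OF u, of c]] bound
    by simp
  also have "\<dots> = c * integral {0..1} (\<lambda>t. t powr \<alpha> * G t powr (1 / q))"
    by simp
  also have "\<dots> \<le> c * (integral {0..1} (\<lambda>t::real. t powr \<alpha>) powr (1 - 1 / q) *
      integral {0..1} (\<lambda>t. t powr \<alpha> * G t) powr (1 / q))"
    using w wG u G0 par pos
    by (intro mult_left_mono power_mean_integral)
      (auto simp: c_def integral_unique[OF w] has_integral_integrable)
  finally show ?thesis
    by (simp add: integral_unique[OF w] integral_unique[OF wG] c_def J_def \<phi>_def A_def)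
qed


section \<open>Return to the fractional integrals and the two endpoints\<close>

text \<open>Reciprocals reverse order: \<open>p < x\<close> puts \<open>1 / p\<close> above
  \<open>1 / x\<close>, hence the right-sided integral, and \<open>x < p\<close> the left-sided one.
  Both intervals have length \<open>\<bar>x - p\<bar> / (p * x)\<close>.\<close>

lemma
  fixes p x \<alpha> :: real and f :: "real \<Rightarrow> real"
  assumes pos: "0 < p" "0 < x"
  defines "J \<equiv> (\<bar>x - p\<bar> / (p * x)) powr \<alpha> / Gamma \<alpha> *
    (LINT t:{0..1}|lebesgue. t powr (\<alpha> - 1) * f (p * x / (t * p + (1 - t) * x)))"
  shows RL_right_reciprocal: "p < x \<Longrightarrow> RL_right \<alpha> (1 / x) (f \<circ> (\<lambda>u. 1 / u)) (1 / p) = J"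
    and RL_left_reciprocal: "x < p \<Longrightarrow> RL_left \<alpha> (1 / x) (f \<circ> (\<lambda>u. 1 / u)) (1 / p) = J"
proof -
  have inv: "1 / (1 / p + (1 / x - 1 / p) * t) = p * x / (t * p + (1 - t) * x)" for t
  proof -
    have "1 / p + (1 / x - 1 / p) * t = (t * p + (1 - t) * x) / (p * x)"
      using pos by (simp add: field_simps)
    then show ?thesis by simp
  qed
  show "RL_right \<alpha> (1 / x) (f \<circ> (\<lambda>u. 1 / u)) (1 / p) = J" if "p < x"
  proof -
    have "1 / p - 1 / x = \<bar>x - p\<bar> / (p * x)" "1 / x < 1 / p"
      using that pos by (simp_all add: field_simps)
    then show ?thesis by (simp only: RL_right_unit_interval J_def o_def inv)
  qed
  show "RL_left \<alpha> (1 / x) (f \<circ> (\<lambda>u. 1 / u)) (1 / p) = J" if "x < p"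
  proof -
    have eq: "1 / x - 1 / p = \<bar>x - p\<bar> / (p * x)" and "1 / p < 1 / x"
      using that pos by (simp_all add: field_simps)
    then show ?thesis by (simp only: RL_left_unit_interval J_def o_def inv eq[symmetric])
  qed
qed

lemma set_lebesgue_integral_singleton:
  fixes g :: "'a::euclidean_space \<Rightarrow> real"
  shows "(LINT t:{c}|lebesgue. g t) = 0"
  unfolding set_lebesgue_integral_def
proof (rule integral_eq_zero_AE)
  show "AE t in lebesgue. indicator {c} t *\<^sub>R g t = 0"
    by (rule AE_I'[of "{c}"]) (auto simp: negligible_iff_null_sets[symmetric] indicator_def)
qed

text \<open>The disjunction on \<open>R\<close> covers either side and the degenerate
  \<open>p = x\<close>, where both sides of the bound vanish because
  \<open>0 powr r = 0\<close>.\<close>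

lemma reciprocal_defect_bound:
  fixes f f' :: "real \<Rightarrow> real"
  assumes K: "convex K" "p \<in> K" "x \<in> K" "K \<subseteq> {0<..}"
    and f': "\<And>y. y \<in> K \<Longrightarrow> (f has_real_derivative f' y) (at y within K)"
    and par: "0 < \<alpha>" "0 < s" "1 \<le> q"
    and hc: "harmonically_s_convex_on s K (\<lambda>y. \<bar>f' y\<bar> powr q)"
    and RL: "(p < x \<and> R = RL_right \<alpha> (1 / x) (f \<circ> (\<lambda>u. 1 / u)) (1 / p)) \<or>
      (x < p \<and> R = RL_left \<alpha> (1 / x) (f \<circ> (\<lambda>u. 1 / u)) (1 / p)) \<or> (p = x \<and> R = 0)"
  shows "\<bar>(\<bar>x - p\<bar> / (p * x)) powr \<alpha> * f x - Gamma (\<alpha> + 1) * R\<bar>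
    \<le> \<bar>x - p\<bar> powr (\<alpha> + 1) / (p * x) powr (\<alpha> - 1) * ((1 / (\<alpha> + 1)) powr (1 - 1 / q) *
      (lambda1 p x s q \<alpha> * \<bar>f' x\<bar> powr q + lambda2 p x s q \<alpha> * \<bar>f' p\<bar> powr q) powr (1 / q))"
    (is "_ \<le> _ * ?B")
proof (cases "p = x")
  case True
  then show ?thesis using RL by auto
next
  case False
  define D where "D = (\<bar>x - p\<bar> / (p * x)) powr \<alpha>"
  define J where "J = (LINT t:{0..1}|lebesgue. t powr (\<alpha> - 1) * f (p * x / (t * p + (1 - t) * x)))"
  have pos: "0 < p" "0 < x" using K by auto
  have R: "R = D / Gamma \<alpha> * J"
    using RL False RL_right_reciprocal[OF pos] RL_left_reciprocal[OF pos] by (auto simp: D_def J_def)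
  have "\<alpha> \<notin> \<int>\<^sub>\<le>\<^sub>0" using par by (auto elim!: nonpos_Ints_cases)
  \<comment> \<open>The functional equation of \<open>Gamma\<close> leaves the factor
    \<open>\<alpha>\<close> that integration by parts requires.\<close>
  then have "Gamma (\<alpha> + 1) * R = D * (\<alpha> * J)"
    using Gamma_real_pos[OF par(1)] Gamma_plus1[of \<alpha>]
    by (simp add: R)
  then have "\<bar>D * f x - Gamma (\<alpha> + 1) * R\<bar> = D * \<bar>f x - \<alpha> * J\<bar>"
    by (simp add: D_def abs_mult flip: right_diff_distrib)
  also have "\<dots> \<le> D * (p * x * \<bar>x - p\<bar> * ?B)"
    unfolding J_def
    by (rule mult_left_mono[OF harmonic_average_defect_bound[OF K f' par hc]]) (simp_all add: D_def)
  also have "\<dots> = \<bar>x - p\<bar> powr (\<alpha> + 1) / (p * x) powr (\<alpha> - 1) * ?B"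
    using pos False by (simp add: D_def powr_divide powr_add powr_diff)
  finally show ?thesis by (simp add: D_def)
qed

theorem theorem9:
  fixes I :: "real set" and f f' :: "real \<Rightarrow> real" and a b \<alpha> s q :: real
  assumes "is_interval I" and "I \<subseteq> {0<..}"
    and "f differentiable_on interior I"
    and "a \<in> I" and "b \<in> I" and "a < b"
    and "\<forall>y\<in>{a..b}. (f has_real_derivative f' y) (at y within I)"
    and "f' absolutely_integrable_on {a..b}"
    and "\<alpha> > 0" and "0 < s" and "s \<le> 1" and "q \<ge> 1"
    and "harmonically_s_convex_on s {a..b} (\<lambda>y. \<bar>f' y\<bar> powr q)"
  shows "\<forall>x\<in>{a..b}.
    \<bar>S_defect f (\<lambda>u. 1 / u) \<alpha> x a b\<bar> \<le>
      (1 / (\<alpha> + 1)) powr (1 - 1 / q) *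
      ((x - a) powr (\<alpha> + 1) / (a * x) powr (\<alpha> - 1) *
         (lambda1 a x s q \<alpha> * \<bar>f' x\<bar> powr q + lambda2 a x s q \<alpha> * \<bar>f' a\<bar> powr q) powr (1 / q)
       + (b - x) powr (\<alpha> + 1) / (b * x) powr (\<alpha> - 1) *
         (lambda3 b x s q \<alpha> * \<bar>f' x\<bar> powr q + lambda4 b x s q \<alpha> * \<bar>f' b\<bar> powr q) powr (1 / q))"
proof
  fix x assume x: "x \<in> {a..b}"
  have pos: "0 < a" "0 < b" "0 < x" using assms(2,4,5) x by auto
  have sub: "{a..b} \<subseteq> I"
    using assms(1,4,5) by (meson atLeastAtMost_iff is_interval_1 subsetI)
  define R L where "R = RL_right \<alpha> (1 / x) (f \<circ> (\<lambda>u. 1 / u)) (1 / a)"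
    and "L = RL_left \<alpha> (1 / x) (f \<circ> (\<lambda>u. 1 / u)) (1 / b)"
  have f': "(f has_real_derivative f' y) (at y within {a..b})" if "y \<in> {a..b}" for y
    using DERIV_subset[OF _ sub] assms(7) that by blast
  have R0: "R = 0" if "a = x"
    using that by (simp add: R_def RL_right_def set_lebesgue_integral_singleton)
  have L0: "L = 0" if "b = x"
    using that by (simp add: L_def RL_left_def set_lebesgue_integral_singleton)
  note bound = reciprocal_defect_bound[OF _ _ x _ f' assms(9,10,12,13)]
  have abs: "\<bar>x - a\<bar> = x - a" "\<bar>x - b\<bar> = b - x"
    using x by auto
  let ?X = "((x - a) / (a * x)) powr \<alpha> * f x - Gamma (\<alpha> + 1) * R"
  let ?Y = "((b - x) / (b * x)) powr \<alpha> * f x - Gamma (\<alpha> + 1) * L"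
  have X: "\<bar>?X\<bar> \<le> (x - a) powr (\<alpha> + 1) / (a * x) powr (\<alpha> - 1) * ((1 / (\<alpha> + 1)) powr (1 - 1 / q) *
      (lambda1 a x s q \<alpha> * \<bar>f' x\<bar> powr q + lambda2 a x s q \<alpha> * \<bar>f' a\<bar> powr q) powr (1 / q))"
    using x pos assms(6) R0 by (intro bound[of a R, unfolded abs]) (auto simp: R_def)
  have Y: "\<bar>?Y\<bar> \<le> (b - x) powr (\<alpha> + 1) / (b * x) powr (\<alpha> - 1) * ((1 / (\<alpha> + 1)) powr (1 - 1 / q) *
      (lambda3 b x s q \<alpha> * \<bar>f' x\<bar> powr q + lambda4 b x s q \<alpha> * \<bar>f' b\<bar> powr q) powr (1 / q))"
    \<comment> \<open>Rewriting to \<open>lambda1\<close> and \<open>lambda2\<close> with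
      \<open>p = b\<close> makes the same one-endpoint bound applicable.\<close>
    unfolding lambda3_eq_lambda1[OF pos(2,3) assms(9,10)] lambda4_eq_lambda2[OF pos(2,3) assms(9,10)]
    using x pos assms(6) L0 by (intro bound[of b L, unfolded abs]) (auto simp: L_def)
  have "S_defect f (\<lambda>u. 1 / u) \<alpha> x a b = ?X + ?Y"
    by (simp add: S_defect_def R_def L_def algebra_simps)
  then have "\<bar>S_defect f (\<lambda>u. 1 / u) \<alpha> x a b\<bar> \<le> \<bar>?X\<bar> + \<bar>?Y\<bar>"
    by (simp only: abs_triangle_ineq)
  also note add_mono[OF X Y]
  finally show "\<bar>S_defect f (\<lambda>u. 1 / u) \<alpha> x a b\<bar> \<le>
      (1 / (\<alpha> + 1)) powr (1 - 1 / q) *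
      ((x - a) powr (\<alpha> + 1) / (a * x) powr (\<alpha> - 1) *
         (lambda1 a x s q \<alpha> * \<bar>f' x\<bar> powr q + lambda2 a x s q \<alpha> * \<bar>f' a\<bar> powr q) powr (1 / q)
       + (b - x) powr (\<alpha> + 1) / (b * x) powr (\<alpha> - 1) *
         (lambda3 b x s q \<alpha> * \<bar>f' x\<bar> powr q + lambda4 b x s q \<alpha> * \<bar>f' b\<bar> powr q) powr (1 / q))"
    by (simp only: distrib_left mult.left_commute)
qed

end
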